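(* Let $(X,\tau,\mathcal{P})$ be a primal topological space. Then the following properties hold: (1) if $A\subseteq X$, then $\Psi(A)=X-(X-A)^{\diamond}$; (2) if $A\subseteq X$, then $\Psi(A)$ is open in $(X,\tau)$; (3) if $A\subseteq B\subseteq X$, then $\Psi(A)\subseteq\Psi(B)$; (4) if $A,B\subseteq X$, then $\Psi(A\cap B)=\Psi(A)\cap\Psi(B)$; (5) if $U\in\tau^{\diamond}$, then $U\subseteq\Psi(U)$; (6) if $A\subseteq X$, then $\Psi(A)\subseteq\Psi(\Psi(A))$; (7) if $A\subseteq X$, then $\Psi(A)=\Psi(\Psi(A))$ if and only if $(X-A)^{\diamond}=((X-A)^{\diamond})^{\diamond}$; (8) if $A\subseteq X$ and $A^{c}\notin\mathcal{P}$, then $\Psi(A)=X-X^{\diamond}$; (9) if $A\subseteq X$, then $A\cap\Psi(A)=\mathrm{int}^{\diamond}(A)$; (10) if $A\subseteq X$ and $I\subseteq X$ with $I^{c}\notin\mathcal{P}$, then $\Psi(A-I)=\Psi(A)$; (11) if $A\subseteq X$ and $I\subseteq X$ with $I^{c}\notin\mathcal{P}$, then $\Psi(A\cup I)=\Psi(A)$; (12) if $A,B\subseteq X$ and $[(A-B)\cup(B-A)]^{c}\notin\mathcal{P}$, then $\Psi(A)=\Psi(B)$.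
   Context: For a nonempty set $X$, $2^X$ is its power set, $A^c=X\setminus A$ is the complement of $A\subseteq X$, and $A-B$ is set difference. A primal on $X$ is a collection $\mathcal{P}\subseteq 2^X$ such that: (i) $X\notin\mathcal{P}$; (ii) if $A\in\mathcal{P}$ and $B\subseteq A$, then $B\in\mathcal{P}$; (iii) if $A\cap B\in\mathcal{P}$, then $A\in\mathcal{P}$ or $B\in\mathcal{P}$. A primal topological space $(X,\tau,\mathcal{P})$ is a topological space $(X,\tau)$ with a primal $\mathcal{P}$ on $X$. For $x\in X$, $\tau(x)$ is the family of all open (i.e. in $\tau$) sets containing $x$. For $A\subseteq X$, $A^{\diamond}=\{x\in X : A^c\cup U^c\in\mathcal{P}\text{ for all }U\in\tau(x)\}$ and $cl^{\diamond}(A)=A\cup A^{\diamond}$. The family $\tau^{\diamond}=\{A\subseteq X : cl^{\diamond}(A^c)=A^c\}$ is a topology on $X$ (the primal topology); $\mathrm{int}^{\diamond}(A)$ is the interior of $A$ with respect to $\tau^{\diamond}$. The operator $\Psi:2^X\to 2^X$ is defined by $\Psi(A)=\{x\in X : \text{there exists }U\in\tau(x)\text{ with }(U-A)^c\notin\mathcal{P}\}$. *)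

theory Defs
  imports "HOL-Analysis.Abstract_Topology"
begin

text \<open>
  The ground set is an explicit carrier \<open>X\<close>; for a topology \<open>T\<close> it is \<open>topspace T\<close>, and
  complements are always taken relative to it.
\<close>

definition primal_on :: "'a set \<Rightarrow> 'a set set \<Rightarrow> bool" where
  "primal_on X P \<longleftrightarrow>
     X \<noteq> {} \<and> P \<subseteq> Pow X \<and>
     X \<notin> P \<and>
     (\<forall>A B. A \<in> P \<longrightarrow> B \<subseteq> A \<longrightarrow> B \<in> P) \<and>
     (\<forall>A B. A \<subseteq> X \<longrightarrow> B \<subseteq> X \<longrightarrow> A \<inter> B \<in> P \<longrightarrow> A \<in> P \<or> B \<in> P)"

definition primal_topological_space :: "'a topology \<Rightarrow> 'a set set \<Rightarrow> bool" where
  "primal_topological_space T P \<longleftrightarrow> primal_on (topspace T) P"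

definition diamond :: "'a topology \<Rightarrow> 'a set set \<Rightarrow> 'a set \<Rightarrow> 'a set" where
  "diamond T P A =
     {x \<in> topspace T. \<forall>U. openin T U \<and> x \<in> U \<longrightarrow> (topspace T - A) \<union> (topspace T - U) \<in> P}"

definition cl_diamond :: "'a topology \<Rightarrow> 'a set set \<Rightarrow> 'a set \<Rightarrow> 'a set" where
  "cl_diamond T P A = A \<union> diamond T P A"

definition primal_topology :: "'a topology \<Rightarrow> 'a set set \<Rightarrow> 'a topology" where
  "primal_topology T P =
     topology (\<lambda>A. A \<subseteq> topspace T \<and> cl_diamond T P (topspace T - A) = topspace T - A)"

definition Psi :: "'a topology \<Rightarrow> 'a set set \<Rightarrow> 'a set \<Rightarrow> 'a set" where
  "Psi T P A =
     {x \<in> topspace T. \<exists>U. openin T U \<and> x \<in> U \<and> topspace T - (U - A) \<notin> P}"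

text \<open>
  The function \<open>topology\<close> is meaningful only on predicates satisfying \<open>istopology\<close>; the following
  lemmas discharge this for \<open>primal_topology\<close>.
\<close>

lemma diamond_mono:
  assumes "primal_topological_space T P" "A \<subseteq> B"
  shows "diamond T P A \<subseteq> diamond T P B"
proof
  fix x assume x: "x \<in> diamond T P A"
  have "(topspace T - B) \<union> (topspace T - U) \<in> P" if "openin T U" "x \<in> U" for U
  proof -
    have "(topspace T - A) \<union> (topspace T - U) \<in> P"
      using x that by (auto simp: diamond_def)
    moreover have "(topspace T - B) \<union> (topspace T - U) \<subseteq> (topspace T - A) \<union> (topspace T - U)"
      using assms(2) by blast
    ultimately show ?thesis
      using assms(1) unfolding primal_topological_space_def primal_on_def by blast
  qed
  then show "x \<in> diamond T P B"
    using x by (auto simp: diamond_def)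
qed

lemma diamond_Un_subset:
  assumes "primal_topological_space T P"
  shows "diamond T P (A \<union> B) \<subseteq> diamond T P A \<union> diamond T P B"
proof
  fix x assume x: "x \<in> diamond T P (A \<union> B)"
  show "x \<in> diamond T P A \<union> diamond T P B"
  proof (rule ccontr)
    assume "x \<notin> diamond T P A \<union> diamond T P B"
    then obtain U V where U: "openin T U" "x \<in> U" "(topspace T - A) \<union> (topspace T - U) \<notin> P"
      and V: "openin T V" "x \<in> V" "(topspace T - B) \<union> (topspace T - V) \<notin> P"
      using x by (auto simp: diamond_def)
    let ?W = "U \<inter> V"
    let ?C = "(topspace T - A) \<union> (topspace T - ?W)"
    let ?D = "(topspace T - B) \<union> (topspace T - ?W)"
    have "(topspace T - (A \<union> B)) \<union> (topspace T - ?W) \<in> P"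
      using x U(1,2) V(1,2) by (auto simp: diamond_def)
    moreover have "(topspace T - (A \<union> B)) \<union> (topspace T - ?W) = ?C \<inter> ?D"
      by blast
    moreover have "?C \<subseteq> topspace T" "?D \<subseteq> topspace T"
      by auto
    ultimately have "?C \<in> P \<or> ?D \<in> P"
      using assms unfolding primal_topological_space_def primal_on_def by metis
    moreover have "(topspace T - A) \<union> (topspace T - U) \<subseteq> ?C"
      "(topspace T - B) \<union> (topspace T - V) \<subseteq> ?D"
      by blast+
    ultimately show False
      using U(3) V(3) assms unfolding primal_topological_space_def primal_on_def by metis
  qed
qed

lemma istopology_primal:
  assumes "primal_topological_space T P"
  shows "istopology (\<lambda>A. A \<subseteq> topspace T \<and> cl_diamond T P (topspace T - A) = topspace T - A)"
proof -
  have *: "cl_diamond T P C = C \<longleftrightarrow> diamond T P C \<subseteq> C" for C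
    by (auto simp: cl_diamond_def)
  show ?thesis
    unfolding istopology_def *
  proof (intro conjI allI impI)
    fix S R
    assume S: "S \<subseteq> topspace T \<and> diamond T P (topspace T - S) \<subseteq> topspace T - S"
      and R: "R \<subseteq> topspace T \<and> diamond T P (topspace T - R) \<subseteq> topspace T - R"
    show "S \<inter> R \<subseteq> topspace T" using S by blast
    have "topspace T - S \<inter> R = (topspace T - S) \<union> (topspace T - R)" by blast
    then show "diamond T P (topspace T - S \<inter> R) \<subseteq> topspace T - S \<inter> R"
      using diamond_Un_subset[OF assms, of "topspace T - S" "topspace T - R"] S R by auto
  next
    fix K
    assume K: "\<forall>S\<in>K. S \<subseteq> topspace T \<and> diamond T P (topspace T - S) \<subseteq> topspace T - S"
    show "\<Union>K \<subseteq> topspace T" using K by blast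
    have "diamond T P (topspace T - \<Union>K) \<subseteq> topspace T - S" if "S \<in> K" for S
      using diamond_mono[OF assms, of "topspace T - \<Union>K" "topspace T - S"] K that by blast
    moreover have "diamond T P (topspace T - \<Union>K) \<subseteq> topspace T"
      by (auto simp: diamond_def)
    ultimately show "diamond T P (topspace T - \<Union>K) \<subseteq> topspace T - \<Union>K"
      by blast
  qed
qed

lemma openin_primal_topology:
  assumes "primal_topological_space T P"
  shows "openin (primal_topology T P) A \<longleftrightarrow>
    A \<subseteq> topspace T \<and> cl_diamond T P (topspace T - A) = topspace T - A"
  unfolding primal_topology_def
  using topology_inverse'[OF istopology_primal[OF assms]] by simp

lemma topspace_primal_topology:
  assumes "primal_topological_space T P"
  shows "topspace (primal_topology T P) = topspace T"
proof (rule antisym)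
  show "topspace (primal_topology T P) \<subseteq> topspace T"
    using openin_primal_topology[OF assms] openin_topspace by blast
  have "diamond T P {} = {}"
    using assms
    by (auto simp: diamond_def primal_topological_space_def primal_on_def Un_absorb2)
  then have "openin (primal_topology T P) (topspace T)"
    by (simp add: openin_primal_topology[OF assms] cl_diamond_def)
  then show "topspace T \<subseteq> topspace (primal_topology T P)"
    by (rule openin_subset)
qed

end

theory Submission
  imports Defs
begin

text \<open>
  Call a set negligible when its complement is not in the primal. The primal axioms are the ideal
  axioms in dual form: \<open>X \<notin> P\<close> makes the empty set negligible, and the other two make negligible sets
  closed under subsets and under finite unions. In these terms \<open>\<Psi>(A)\<close> is the set of points having a
  neighbourhood that is contained in \<open>A\<close> up to a negligible set, the interior operator modulo
  an ideal that is dual to the local function \<open>diamond\<close>.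

  Two observations carry everything. First, \<open>\<Psi>\<close> only sees \<open>A\<close> up to negligible sets: if
  \<open>A - B\<close> is negligible then \<open>\<Psi>(A) \<subseteq> \<Psi>(B)\<close>, since \<open>U - B \<subseteq> (U - A) \<union> (A - B)\<close>
  (\<open>Psi_mono_negligible\<close>). This contains monotonicity and all the invariance properties.
  Secondly, \<open>S\<close> is open in the primal topology iff \<open>S \<subseteq> \<Psi>(S)\<close> (\<open>openin_primal_iff_subset_Psi\<close>).
  Together with \<open>\<Psi>(A \<inter> B) = \<Psi>(A) \<inter> \<Psi>(B)\<close> and \<open>\<Psi>(A) \<subseteq> \<Psi>(\<Psi>(A))\<close>, it follows that
  \<open>A \<inter> \<Psi>(A)\<close> is open in the primal topology, and it is the largest such subset of \<open>A\<close>.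
\<close>

definition negligible_wrt :: "'a topology \<Rightarrow> 'a set set \<Rightarrow> 'a set \<Rightarrow> bool" where
  "negligible_wrt T P I \<longleftrightarrow> topspace T - I \<notin> P"

lemma negligible_wrt_empty:
  assumes "primal_topological_space T P"
  shows "negligible_wrt T P {}"
  using assms unfolding negligible_wrt_def primal_topological_space_def primal_on_def by simp

lemma negligible_wrt_subset:
  assumes "primal_topological_space T P" "negligible_wrt T P J" "I \<subseteq> J"
  shows "negligible_wrt T P I"
proof -
  have "topspace T - J \<subseteq> topspace T - I" using assms(3) by blast
  then show ?thesis
    using assms(1,2) unfolding negligible_wrt_def primal_topological_space_def primal_on_def by metis
qed

lemma negligible_wrt_Un:
  assumes "primal_topological_space T P" "negligible_wrt T P I" "negligible_wrt T P J"
  shows "negligible_wrt T P (I \<union> J)"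
proof -
  have "topspace T - (I \<union> J) = (topspace T - I) \<inter> (topspace T - J)" by blast
  then show ?thesis
    using assms unfolding negligible_wrt_def primal_topological_space_def primal_on_def
    by (metis Diff_subset)
qed

lemma mem_Psi_iff:
  "x \<in> Psi T P A \<longleftrightarrow> (\<exists>U. openin T U \<and> x \<in> U \<and> negligible_wrt T P (U - A))"
  unfolding Psi_def negligible_wrt_def using openin_subset by blast

lemma Psi_eq_compl_diamond:
  assumes "A \<subseteq> topspace T"
  shows "Psi T P A = topspace T - diamond T P (topspace T - A)"
proof -
  have "(topspace T - (topspace T - A)) \<union> (topspace T - U) = topspace T - (U - A)" for U
    using assms by blast
  then show ?thesis
    by (auto simp: Psi_def diamond_def)
qed

text \<open>A neighbourhood witnessing that one point lies in \<open>\<Psi>(A)\<close> witnesses it for all its points.\<close>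

lemma openin_Psi: "openin T (Psi T P A)"
proof (subst openin_subopen, intro ballI)
  fix x assume "x \<in> Psi T P A"
  then obtain U where "openin T U" "x \<in> U" "negligible_wrt T P (U - A)"
    by (auto simp: mem_Psi_iff)
  then show "\<exists>U. openin T U \<and> x \<in> U \<and> U \<subseteq> Psi T P A"
    by (intro exI[of _ U]) (auto simp: mem_Psi_iff)
qed

text \<open>The excess \<open>U - B\<close> of a neighbourhood over \<open>B\<close> is covered by \<open>U - A\<close> and \<open>A - B\<close>.\<close>

lemma Psi_mono_negligible:
  assumes "primal_topological_space T P" "negligible_wrt T P (A - B)"
  shows "Psi T P A \<subseteq> Psi T P B"
proof
  fix x assume "x \<in> Psi T P A"
  then obtain U where U: "openin T U" "x \<in> U" "negligible_wrt T P (U - A)"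
    by (auto simp: mem_Psi_iff)
  have "negligible_wrt T P ((U - A) \<union> (A - B))"
    using negligible_wrt_Un[OF assms(1) U(3) assms(2)] .
  then have "negligible_wrt T P (U - B)"
    by (rule negligible_wrt_subset[OF assms(1)]) blast
  then show "x \<in> Psi T P B"
    using U(1,2) by (auto simp: mem_Psi_iff)
qed

lemma Psi_mono:
  assumes "primal_topological_space T P" "A \<subseteq> B"
  shows "Psi T P A \<subseteq> Psi T P B"
proof -
  have "A - B = {}" using assms(2) by blast
  then show ?thesis
    using Psi_mono_negligible[OF assms(1)] negligible_wrt_empty[OF assms(1)] by metis
qed

lemma Psi_eq_if_negligible_sym_diff:
  assumes "primal_topological_space T P" "negligible_wrt T P ((A - B) \<union> (B - A))"
  shows "Psi T P A = Psi T P B"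
  by (intro subset_antisym Psi_mono_negligible[OF assms(1)])
    (rule negligible_wrt_subset[OF assms], blast)+

lemma Psi_Int:
  assumes "primal_topological_space T P"
  shows "Psi T P (A \<inter> B) = Psi T P A \<inter> Psi T P B"
proof (rule subset_antisym)
  show "Psi T P (A \<inter> B) \<subseteq> Psi T P A \<inter> Psi T P B"
    using Psi_mono[OF assms, of "A \<inter> B"] by simp
  show "Psi T P A \<inter> Psi T P B \<subseteq> Psi T P (A \<inter> B)"
  proof
    fix x assume "x \<in> Psi T P A \<inter> Psi T P B"
    then obtain U V where U: "openin T U" "x \<in> U" "negligible_wrt T P (U - A)"
      and V: "openin T V" "x \<in> V" "negligible_wrt T P (V - B)"
      by (auto simp: mem_Psi_iff)
    have "negligible_wrt T P ((U - A) \<union> (V - B))"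
      using negligible_wrt_Un[OF assms U(3) V(3)] .
    then have "negligible_wrt T P (U \<inter> V - A \<inter> B)"
      by (rule negligible_wrt_subset[OF assms]) blast
    then show "x \<in> Psi T P (A \<inter> B)"
      using U(1,2) V(1,2) unfolding mem_Psi_iff by blast
  qed
qed

text \<open>An open set is itself a witnessing neighbourhood, with empty excess.\<close>

lemma openin_subset_Psi:
  assumes "primal_topological_space T P" "openin T V"
  shows "V \<subseteq> Psi T P V"
proof
  fix x assume "x \<in> V"
  moreover have "negligible_wrt T P (V - V)"
    using negligible_wrt_empty[OF assms(1)] by simp
  ultimately show "x \<in> Psi T P V"
    using assms(2) unfolding mem_Psi_iff by blast
qed

text \<open>
  The complement of \<open>S\<close> is closed under \<open>diamond\<close> exactly when \<open>S\<close> is disjoint from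
  \<open>diamond\<close> of its complement, which is the complement of \<open>\<Psi>(S)\<close>.
\<close>

lemma openin_primal_iff_subset_Psi:
  assumes "primal_topological_space T P"
  shows "openin (primal_topology T P) S \<longleftrightarrow> S \<subseteq> topspace T \<and> S \<subseteq> Psi T P S"
proof (cases "S \<subseteq> topspace T")
  case True
  have "diamond T P (topspace T - S) \<subseteq> topspace T"
    by (auto simp: diamond_def)
  then have "cl_diamond T P (topspace T - S) = topspace T - S \<longleftrightarrow> S \<subseteq> Psi T P S"
    unfolding cl_diamond_def Psi_eq_compl_diamond[OF True] using True by blast
  then show ?thesis
    using True by (simp add: openin_primal_topology[OF assms])
qed (simp add: openin_primal_topology[OF assms])

lemma interior_of_primal_topology:
  assumes "primal_topological_space T P" "A \<subseteq> topspace T"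
  shows "primal_topology T P interior_of A = A \<inter> Psi T P A"
proof (rule interior_of_unique)
  have "Psi T P (A \<inter> Psi T P A) = Psi T P A"
    using Psi_Int[OF assms(1)] openin_subset_Psi[OF assms(1) openin_Psi] by blast
  then show "openin (primal_topology T P) (A \<inter> Psi T P A)"
    using assms(2) by (auto simp: openin_primal_iff_subset_Psi[OF assms(1)])
  fix S assume "S \<subseteq> A" "openin (primal_topology T P) S"
  then show "S \<subseteq> A \<inter> Psi T P A"
    using Psi_mono[OF assms(1) \<open>S \<subseteq> A\<close>] by (auto simp: openin_primal_iff_subset_Psi[OF assms(1)])
qed simp

text \<open>
  Since \<open>\<Psi>\<close> and \<open>diamond\<close> are conjugate under complementation, so are their
  iterates, and one is idempotent at \<open>A\<close> iff the other is at the complement of \<open>A\<close>.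
\<close>

lemma Psi_idem_iff_diamond_idem:
  assumes "A \<subseteq> topspace T"
  shows "Psi T P A = Psi T P (Psi T P A) \<longleftrightarrow>
    diamond T P (topspace T - A) = diamond T P (diamond T P (topspace T - A))"
proof -
  let ?D = "diamond T P (topspace T - A)"
  have D: "diamond T P B \<subseteq> topspace T" for B
    by (auto simp: diamond_def)
  have P: "Psi T P A = topspace T - ?D"
    by (rule Psi_eq_compl_diamond[OF assms])
  have "topspace T - (topspace T - ?D) = ?D"
    using D by blast
  then have "Psi T P (Psi T P A) = topspace T - diamond T P ?D"
    unfolding P by (simp add: Psi_eq_compl_diamond)
  then show ?thesis
    unfolding P using D[of "topspace T - A"] D[of ?D] by blast
qed

lemma Psi_Diff_negligible:
  assumes "primal_topological_space T P" "negligible_wrt T P I"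
  shows "Psi T P (A - I) = Psi T P A"
  by (rule Psi_eq_if_negligible_sym_diff[OF assms(1)], rule negligible_wrt_subset[OF assms]) blast

lemma Psi_Un_negligible:
  assumes "primal_topological_space T P" "negligible_wrt T P I"
  shows "Psi T P (A \<union> I) = Psi T P A"
  by (rule Psi_eq_if_negligible_sym_diff[OF assms(1)], rule negligible_wrt_subset[OF assms]) blast

text \<open>A negligible set has the same \<open>\<Psi>\<close> as the empty set.\<close>

lemma Psi_negligible:
  assumes "primal_topological_space T P" "negligible_wrt T P A"
  shows "Psi T P A = topspace T - diamond T P (topspace T)"
  using Psi_Diff_negligible[OF assms, of A] Psi_eq_compl_diamond[of "{}" T P] by simp

theorem theorem3p6:
  fixes T :: "'a topology" and P :: "'a set set"
  assumes "primal_topological_space T P"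
  shows
    "(\<forall>A. A \<subseteq> topspace T \<longrightarrow> Psi T P A = topspace T - diamond T P (topspace T - A)) \<and>
     (\<forall>A. A \<subseteq> topspace T \<longrightarrow> openin T (Psi T P A)) \<and>
     (\<forall>A B. A \<subseteq> B \<and> B \<subseteq> topspace T \<longrightarrow> Psi T P A \<subseteq> Psi T P B) \<and>
     (\<forall>A B. A \<subseteq> topspace T \<and> B \<subseteq> topspace T \<longrightarrow> Psi T P (A \<inter> B) = Psi T P A \<inter> Psi T P B) \<and>
     (\<forall>U. openin (primal_topology T P) U \<longrightarrow> U \<subseteq> Psi T P U) \<and>
     (\<forall>A. A \<subseteq> topspace T \<longrightarrow> Psi T P A \<subseteq> Psi T P (Psi T P A)) \<and>
     (\<forall>A. A \<subseteq> topspace T \<longrightarrow>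
        (Psi T P A = Psi T P (Psi T P A) \<longleftrightarrow>
         diamond T P (topspace T - A) = diamond T P (diamond T P (topspace T - A)))) \<and>
     (\<forall>A. A \<subseteq> topspace T \<and> topspace T - A \<notin> P \<longrightarrow>
        Psi T P A = topspace T - diamond T P (topspace T)) \<and>
     (\<forall>A. A \<subseteq> topspace T \<longrightarrow> A \<inter> Psi T P A = (primal_topology T P) interior_of A) \<and>
     (\<forall>A I. A \<subseteq> topspace T \<and> I \<subseteq> topspace T \<and> topspace T - I \<notin> P \<longrightarrow>
        Psi T P (A - I) = Psi T P A) \<and>
     (\<forall>A I. A \<subseteq> topspace T \<and> I \<subseteq> topspace T \<and> topspace T - I \<notin> P \<longrightarrow>
        Psi T P (A \<union> I) = Psi T P A) \<and>
     (\<forall>A B. A \<subseteq> topspace T \<and> B \<subseteq> topspace T \<and> topspace T - ((A - B) \<union> (B - A)) \<notin> P \<longrightarrow>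
        Psi T P A = Psi T P B)"
proof (intro conjI allI impI; (elim conjE)?)
  fix A
  show "openin T (Psi T P A)" by (rule openin_Psi)
  show "Psi T P A \<subseteq> Psi T P (Psi T P A)"
    by (rule openin_subset_Psi[OF assms openin_Psi])
  assume A: "A \<subseteq> topspace T"
  show "Psi T P A = topspace T - diamond T P (topspace T - A)"
    by (rule Psi_eq_compl_diamond[OF A])
  show "Psi T P A = Psi T P (Psi T P A) \<longleftrightarrow>
      diamond T P (topspace T - A) = diamond T P (diamond T P (topspace T - A))"
    by (rule Psi_idem_iff_diamond_idem[OF A])
  show "A \<inter> Psi T P A = primal_topology T P interior_of A"
    using interior_of_primal_topology[OF assms A] by simp
  show "Psi T P A = topspace T - diamond T P (topspace T)" if "topspace T - A \<notin> P"
    using Psi_negligible[OF assms] that by (simp add: negligible_wrt_def)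
next
  fix U assume "openin (primal_topology T P) U"
  then show "U \<subseteq> Psi T P U"
    by (simp add: openin_primal_iff_subset_Psi[OF assms])
next
  fix A B :: "'a set"
  show "Psi T P A \<subseteq> Psi T P B" if "A \<subseteq> B"
    by (rule Psi_mono[OF assms that])
  show "Psi T P (A \<inter> B) = Psi T P A \<inter> Psi T P B"
    by (rule Psi_Int[OF assms])
  show "Psi T P A = Psi T P B" if "topspace T - ((A - B) \<union> (B - A)) \<notin> P"
    using Psi_eq_if_negligible_sym_diff[OF assms] that by (simp add: negligible_wrt_def)
next
  fix A I assume "topspace T - I \<notin> P"
  then have I: "negligible_wrt T P I" by (simp add: negligible_wrt_def)
  show "Psi T P (A - I) = Psi T P A" by (rule Psi_Diff_negligible[OF assms I])
  show "Psi T P (A \<union> I) = Psi T P A" by (rule Psi_Un_negligible[OF assms I])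
qed

end
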